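(* Fix $0<\alpha<1/2$ and let $B=(L,U)$ be a $1-\alpha$ confidence band over $\mathbb{R}^n$. Then, for every $0<\epsilon<(1/2)-\alpha$ (with $n\epsilon^2\ge 1$), $$\inf_{f\in\mathbb{R}^n}\mathbb{E}_f(W)\ge(1-2\alpha-2\epsilon)\,\sigma\sqrt{\log(n\epsilon^2)} .$$ The bound is achieved up to constants by the fixed-width Bonferroni band $$L_i=Y_i-\sigma z_{\alpha/(2n)},\qquad U_i=Y_i+\sigma z_{\alpha/(2n)},\qquad i=1,\dots,n;$$ that is, this band is a $1-\alpha$ confidence band over $\mathbb{R}^n$ and, for fixed $\alpha$ and $\epsilon$, its (nonrandom) width is at most a constant (not depending on $n$ or $\sigma$) times $(1-2\alpha-2\epsilon)\,\sigma\sqrt{\log(n\epsilon^2)}$ for all sufficiently large $n$.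
   Context: Observations: $Y_i=f_i+\sigma\epsilon_i$, $i=1,\dots,n$, where $\epsilon_1,\dots,\epsilon_n$ are independent $N(0,1)$, $f=(f_1,\dots,f_n)\in\mathbb{R}^n$ is unknown and $\sigma>0$ is a known constant. $\mathbb{P}_f,\mathbb{E}_f$ denote probability and expectation when the mean vector is $f$. A band $B=(L,U)$ is a pair of random vectors $L=L(Y)$, $U=U(Y)$ in $\mathbb{R}^n$ with $L\le U$ coordinatewise. It is a $1-\alpha$ confidence band over $\mathbb{R}^n$ if $\inf_{f\in\mathbb{R}^n}\mathbb{P}_f(L\le f\le U)\ge 1-\alpha$ (coordinatewise inequalities). Its width is $W=\max_{1\le i\le n}(U_i-L_i)$. $z_\beta$ denotes the upper-tail $\beta$-quantile of the standard normal distribution, i.e. $1-\Phi(z_\beta)=\beta$, where $\Phi$ is the standard normal cumulative distribution function. *)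

theory Defs
  imports "HOL-Probability.Probability"
begin

text \<open>
  The dimension is quantified inside the statements, so a vector in n-dimensional Euclidean space
  is an element of the product \<open>\<Pi>\<^sub>E i\<in>{1..n}. UNIV\<close>, i.e. a function that is
  \<open>undefined\<close> outside the index set.
\<close>

abbreviation Rn :: "nat \<Rightarrow> (nat \<Rightarrow> real) measure" where
  "Rn n \<equiv> (\<Pi>\<^sub>M i\<in>{1..n}. borel)"

text \<open>The law of \<open>Y\<close> with \<open>Y\<^sub>i = f\<^sub>i + \<sigma> \<epsilon>\<^sub>i\<close>.\<close>

definition obs_law :: "nat \<Rightarrow> real \<Rightarrow> (nat \<Rightarrow> real) \<Rightarrow> (nat \<Rightarrow> real) measure" where
  "obs_law n \<sigma> f =
     distr (\<Pi>\<^sub>M i\<in>{1..n}. std_normal_distribution) (Rn n) (\<lambda>e. \<lambda>i\<in>{1..n}. f i + \<sigma> * e i)"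

definition band ::
  "nat \<Rightarrow> ((nat \<Rightarrow> real) \<Rightarrow> nat \<Rightarrow> real) \<Rightarrow> ((nat \<Rightarrow> real) \<Rightarrow> nat \<Rightarrow> real) \<Rightarrow> bool" where
  "band n L U \<longleftrightarrow>
     L \<in> measurable (Rn n) (Rn n) \<and> U \<in> measurable (Rn n) (Rn n) \<and>
     (\<forall>y\<in>space (Rn n). \<forall>i\<in>{1..n}. L y i \<le> U y i)"

definition confidence_band ::
  "nat \<Rightarrow> real \<Rightarrow> real \<Rightarrow>
     ((nat \<Rightarrow> real) \<Rightarrow> nat \<Rightarrow> real) \<Rightarrow> ((nat \<Rightarrow> real) \<Rightarrow> nat \<Rightarrow> real) \<Rightarrow> bool" where
  "confidence_band n \<sigma> \<alpha> L U \<longleftrightarrow>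
     band n L U \<and>
     (INF f\<in>space (Rn n). measure (obs_law n \<sigma> f)
        {y \<in> space (Rn n). \<forall>i\<in>{1..n}. L y i \<le> f i \<and> f i \<le> U y i}) \<ge> 1 - \<alpha>"

definition width ::
  "nat \<Rightarrow> ((nat \<Rightarrow> real) \<Rightarrow> nat \<Rightarrow> real) \<Rightarrow> ((nat \<Rightarrow> real) \<Rightarrow> nat \<Rightarrow> real) \<Rightarrow> (nat \<Rightarrow> real) \<Rightarrow> real" where
  "width n L U y = Max ((\<lambda>i. U y i - L y i) ` {1..n})"

text \<open>The width is nonnegative and its expectation may be infinite, hence the extended integral.\<close>

definition expected_width ::
  "nat \<Rightarrow> real \<Rightarrow> ((nat \<Rightarrow> real) \<Rightarrow> nat \<Rightarrow> real) \<Rightarrow> ((nat \<Rightarrow> real) \<Rightarrow> nat \<Rightarrow> real) \<Rightarrow>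
     (nat \<Rightarrow> real) \<Rightarrow> ennreal" where
  "expected_width n \<sigma> L U f = (\<integral>\<^sup>+ y. ennreal (width n L U y) \<partial>obs_law n \<sigma> f)"

text \<open>Meaningful for \<open>0 < \<beta> < 1\<close>, where the quantile exists and is unique.\<close>

definition upper_quantile :: "real \<Rightarrow> real" where
  "upper_quantile \<beta> = (THE z. 1 - cdf std_normal_distribution z = \<beta>)"

definition bonferroni_lower :: "nat \<Rightarrow> real \<Rightarrow> real \<Rightarrow> (nat \<Rightarrow> real) \<Rightarrow> nat \<Rightarrow> real" where
  "bonferroni_lower n \<sigma> \<alpha> y = (\<lambda>i\<in>{1..n}. y i - \<sigma> * upper_quantile (\<alpha> / (2 * real n)))"

definition bonferroni_upper :: "nat \<Rightarrow> real \<Rightarrow> real \<Rightarrow> (nat \<Rightarrow> real) \<Rightarrow> nat \<Rightarrow> real" where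
  "bonferroni_upper n \<sigma> \<alpha> y = (\<lambda>i\<in>{1..n}. y i + \<sigma> * upper_quantile (\<alpha> / (2 * real n)))"

end

theory Submission
  imports Defs
begin

text \<open>
  The lower bound compares a mean vector \<open>f\<close> with its \<open>n\<close> perturbations, in which a single
  coordinate is raised by \<open>\<sigma> * a\<close>. Any band that covers both \<open>f\<close> and a perturbation has width at
  least \<open>\<sigma> * a\<close>. If the position of the raised coordinate is uniformly random, the law of the data is
  a mixture whose likelihood ratio to the law under \<open>f\<close> is an average of \<open>n\<close> uncorrelated variables
  with variance \<open>exp (a\<^sup>2) - 1\<close>. Its variance is thus \<open>(exp (a\<^sup>2) - 1) / n\<close>, which is less than
  \<open>\<epsilon>\<^sup>2\<close> for \<open>a = sqrt (ln (n * \<epsilon>\<^sup>2))\<close>, and no event has probabilities under the mixture and under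
  \<open>f\<close> that differ by more than \<open>\<epsilon>\<close> (\<open>mixture_close\<close>). A band that covers the truth with probability
  \<open>1 - \<alpha>\<close> must then, under the mixture, cover \<open>f\<close> and the perturbed mean together, and so be wide,
  with probability at least \<open>1 - 2 * \<alpha> - \<epsilon>\<close>. Being wide is an event in its own right, so it has
  probability at least \<open>1 - 2 * \<alpha> - 2 * \<epsilon>\<close> when the mean is \<open>f\<close> (\<open>prob_wide\<close>). Markov's
  inequality finishes the argument (\<open>expected_width_ge\<close>).

  The Bonferroni band covers by a union bound over the coordinates
  (\<open>bonferroni_confidence_band\<close>). Its width is twice a normal quantile times \<open>\<sigma>\<close>, which by the
  Chernoff tail bound is of order \<open>\<sigma> * sqrt (ln n)\<close> (\<open>bonferroni_width_le\<close>).
\<close>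

section \<open>Translating standard Gaussian noise along one axis\<close>

abbreviation gauss :: "'i set \<Rightarrow> ('i \<Rightarrow> real) measure" where
  "gauss I \<equiv> PiM I (\<lambda>_. std_normal_distribution)"

text \<open>
  The likelihood ratio at \<open>x\<close> between unit-variance normal noise with mean \<open>a\<close> in coordinate \<open>j\<close>
  (and mean \<open>0\<close> elsewhere) and centred noise.
\<close>

definition tilt :: "real \<Rightarrow> 'i \<Rightarrow> ('i \<Rightarrow> real) \<Rightarrow> real" where
  "tilt a j x = exp (a * x j - a\<^sup>2 / 2)"

lemma prob_space_std_normal: "prob_space std_normal_distribution"
  using real_dist_normal_dist real_distribution_def by blast

lemma prob_space_gauss: "prob_space (gauss I)"
  by (intro prob_space_PiM prob_space_std_normal)

lemma sets_gauss: "sets (gauss I) = sets (\<Pi>\<^sub>M i\<in>I. borel)"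
  by (intro sets_PiM_cong) auto

lemma measurable_coord [measurable]: "j \<in> I \<Longrightarrow> (\<lambda>x. x j) \<in> borel_measurable (gauss I)"
  by (subst measurable_cong_sets[OF sets_gauss refl]) simp

lemma tilt_measurable [measurable]: "j \<in> I \<Longrightarrow> tilt a j \<in> borel_measurable (gauss I)"
  unfolding tilt_def by measurable

text \<open>
  Completing the square gives \<open>\<phi> (y - a) = \<phi> y * exp (a * y - a\<^sup>2 / 2)\<close> for the standard normal
  density \<open>\<phi>\<close>.
\<close>

lemma std_normal_translate:
  assumes [measurable]: "h \<in> borel_measurable borel"
  shows "(\<integral>\<^sup>+ y. h (y + a) \<partial>std_normal_distribution)
       = (\<integral>\<^sup>+ y. h y * ennreal (exp (a * y - a\<^sup>2 / 2)) \<partial>std_normal_distribution)"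
proof -
  have dens: "std_normal_density (y - a) = std_normal_density y * exp (a * y - a\<^sup>2 / 2)" for y :: real
    unfolding std_normal_density_def
    by (simp add: exp_add[symmetric] field_simps power2_eq_square)
  have "(\<integral>\<^sup>+ y. h (y + a) \<partial>std_normal_distribution)
      = (\<integral>\<^sup>+ y. ennreal (std_normal_density y) * h (y + a) \<partial>lborel)"
    by (subst nn_integral_density) auto
  also have "\<dots> = (\<integral>\<^sup>+ y. ennreal (std_normal_density (y - a)) * h y \<partial>lborel)"
    using nn_integral_real_affine[of "\<lambda>y. ennreal (std_normal_density (y - a)) * h y" 1 a]
    by (simp add: add.commute)
  also have "\<dots> = (\<integral>\<^sup>+ y. ennreal (std_normal_density y) * (h y * ennreal (exp (a * y - a\<^sup>2 / 2))) \<partial>lborel)"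
    by (simp add: dens ennreal_mult mult_ac)
  also have "\<dots> = (\<integral>\<^sup>+ y. h y * ennreal (exp (a * y - a\<^sup>2 / 2)) \<partial>std_normal_distribution)"
    by (subst nn_integral_density) auto
  finally show ?thesis .
qed

lemma translate_measurable [measurable]:
  assumes j: "j \<in> I"
  shows "(\<lambda>x. x(j := x j + a)) \<in> measurable (gauss I) (gauss I)"
  using j by (intro measurable_fun_upd[where J = I]) auto

text \<open>
  By Fubini only the coordinate \<open>j\<close> matters, and there the one-dimensional formula applies. All
  moments of the likelihood ratios below come from this change of measure, so that no Gaussian
  integral has to be computed.
\<close>

lemma gauss_translate:
  assumes I: "finite I" and j: "j \<in> I" and h: "h \<in> borel_measurable (gauss I)"
  shows "(\<integral>\<^sup>+ x. h (x(j := x j + a)) \<partial>gauss I) = (\<integral>\<^sup>+ x. h x * ennreal (tilt a j x) \<partial>gauss I)"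
proof -
  interpret product_sigma_finite "\<lambda>_::'a. std_normal_distribution"
    by (intro product_sigma_finite.intro prob_space_imp_sigma_finite prob_space_std_normal)
  define J where "J = I - {j}"
  have J: "finite J" "j \<notin> J" "I = insert j J"
    using I j by (auto simp: J_def)
  have m1: "(\<lambda>x. h (x(j := x j + a))) \<in> borel_measurable (gauss (insert j J))"
    using measurable_compose[OF translate_measurable[OF j] h] J(3) by simp
  have m2: "(\<lambda>x. h x * ennreal (tilt a j x)) \<in> borel_measurable (gauss (insert j J))"
    using h j J(3) by (auto intro!: borel_measurable_times_ennreal measurable_compose[OF _ measurable_ennreal] tilt_measurable)
  have slice: "(\<lambda>y. h (x(j := y))) \<in> borel_measurable borel" if x: "x \<in> space (gauss J)" for x
  proof -
    have "(\<lambda>y. x(j := y)) \<in> measurable std_normal_distribution (gauss I)"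
      using x J by (intro measurable_fun_upd[where J = J]) auto
    from measurable_compose[OF this h] show ?thesis by simp
  qed
  have "(\<integral>\<^sup>+ x. h (x(j := x j + a)) \<partial>gauss I)
      = (\<integral>\<^sup>+ x. \<integral>\<^sup>+ y. h (x(j := y + a)) \<partial>std_normal_distribution \<partial>gauss J)"
    unfolding J(3) by (subst product_nn_integral_insert[OF J(1,2) m1]) simp
  also have "\<dots> = (\<integral>\<^sup>+ x. \<integral>\<^sup>+ y. h (x(j := y)) * ennreal (exp (a * y - a\<^sup>2 / 2))
      \<partial>std_normal_distribution \<partial>gauss J)"
    by (intro nn_integral_cong std_normal_translate slice)
  also have "\<dots> = (\<integral>\<^sup>+ x. h x * ennreal (tilt a j x) \<partial>gauss I)"
    unfolding J(3) by (subst product_nn_integral_insert[OF J(1,2) m2]) (simp add: tilt_def)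
  finally show ?thesis .
qed

lemma tilt_nonneg: "0 \<le> tilt a j x"
  by (simp add: tilt_def)

lemma nn_integral_tilt:
  assumes "finite I" "j \<in> I"
  shows "(\<integral>\<^sup>+ x. ennreal (tilt a j x) \<partial>gauss I) = 1"
  using gauss_translate[OF assms, of "\<lambda>_. 1" a] prob_space.emeasure_space_1[OF prob_space_gauss, of I]
  by simp

text \<open>
  Absorb the factor \<open>tilt a j\<close> into a translation along \<open>j\<close>: it leaves \<open>tilt a i\<close> alone if
  \<open>i \<noteq> j\<close>, and multiplies it by \<open>exp (a\<^sup>2)\<close> if \<open>i = j\<close>. The ratios for different axes are therefore
  uncorrelated, which is what makes their average concentrate.
\<close>

lemma nn_integral_tilt_mult:
  assumes "finite I" "i \<in> I" "j \<in> I"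
  shows "(\<integral>\<^sup>+ x. ennreal (tilt a i x * tilt a j x) \<partial>gauss I) = ennreal (if i = j then exp (a\<^sup>2) else 1)"
proof -
  have "(\<integral>\<^sup>+ x. ennreal (tilt a i x * tilt a j x) \<partial>gauss I)
      = (\<integral>\<^sup>+ x. ennreal (tilt a i (x(j := x j + a))) \<partial>gauss I)"
    using gauss_translate[OF assms(1,3), of "\<lambda>x. ennreal (tilt a i x)" a] assms
    by (simp add: ennreal_mult tilt_nonneg)
  also have "\<dots> = (\<integral>\<^sup>+ x. ennreal (if i = j then exp (a\<^sup>2) else 1) * ennreal (tilt a i x) \<partial>gauss I)"
    by (intro nn_integral_cong)
       (auto simp: tilt_def ennreal_mult[symmetric] exp_add[symmetric] algebra_simps power2_eq_square)
  also have "\<dots> = ennreal (if i = j then exp (a\<^sup>2) else 1)"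
    using assms by (subst nn_integral_cmult) (auto simp: nn_integral_tilt)
  finally show ?thesis .
qed

lemma tilt_mult:
  assumes "finite I" "i \<in> I" "j \<in> I"
  shows "integrable (gauss I) (\<lambda>x. tilt a i x * tilt a j x)"
    and "(LINT x|gauss I. tilt a i x * tilt a j x) = (if i = j then exp (a\<^sup>2) else 1)"
proof -
  have "integrable (gauss I) (\<lambda>x. tilt a i x * tilt a j x) \<and>
    (LINT x|gauss I. tilt a i x * tilt a j x) = (if i = j then exp (a\<^sup>2) else 1)"
    by (subst nn_integral_eq_integrable[symmetric])
       (use assms in \<open>auto simp: nn_integral_tilt_mult tilt_nonneg\<close>)
  then show "integrable (gauss I) (\<lambda>x. tilt a i x * tilt a j x)"
    and "(LINT x|gauss I. tilt a i x * tilt a j x) = (if i = j then exp (a\<^sup>2) else 1)" by auto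
qed

lemma integral_tilt_indicator:
  assumes "finite I" "j \<in> I" and A: "A \<in> sets (gauss I)"
  shows "integrable (gauss I) (\<lambda>x. indicator A x * tilt a j x)"
    and "(LINT x|gauss I. indicator A x * tilt a j x)
         = measure (gauss I) {x \<in> space (gauss I). x(j := x j + a) \<in> A}"
proof -
  interpret prob_space "gauss I" by (rule prob_space_gauss)
  let ?S = "{x \<in> space (gauss I). x(j := x j + a) \<in> A}"
  have S: "?S \<in> sets (gauss I)"
    using measurable_sets[OF translate_measurable[OF assms(2), of a] A]
    by (simp add: vimage_def Int_def conj_commute)
  have "(\<integral>\<^sup>+ x. ennreal (indicator A x * tilt a j x) \<partial>gauss I)
      = (\<integral>\<^sup>+ x. indicator A x * ennreal (tilt a j x) \<partial>gauss I)"
    by (intro nn_integral_cong) (auto split: split_indicator)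
  also have "\<dots> = (\<integral>\<^sup>+ x. indicator A (x(j := x j + a)) \<partial>gauss I)"
    using gauss_translate[OF assms(1,2), of "indicator A" a] A by simp
  also have "\<dots> = (\<integral>\<^sup>+ x. indicator ?S x \<partial>gauss I)"
    by (intro nn_integral_cong) (auto split: split_indicator)
  also have "\<dots> = ennreal (prob ?S)"
    using S by (simp add: emeasure_eq_measure)
  finally have *: "(\<integral>\<^sup>+ x. ennreal (indicator A x * tilt a j x) \<partial>gauss I) = ennreal (prob ?S)" .
  have "integrable (gauss I) (\<lambda>x. indicator A x * tilt a j x) \<and>
    (LINT x|gauss I. indicator A x * tilt a j x) = prob ?S"
    by (subst nn_integral_eq_integrable[symmetric])
       (use assms * in \<open>auto simp: tilt_nonneg\<close>)
  then show "integrable (gauss I) (\<lambda>x. indicator A x * tilt a j x)"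
    and "(LINT x|gauss I. indicator A x * tilt a j x) = prob ?S" by auto
qed

section \<open>A sparse mixture is hard to tell from its centre\<close>

text \<open>
  Averaging over the axis \<open>j\<close> reduces the variance of the likelihood ratio by the factor
  \<open>card I\<close>, to \<open>(exp (a\<^sup>2) - 1) / card I\<close>. Its root bounds the change of the probability of any
  event, by Cauchy-Schwarz. So the shift \<open>a\<close> may grow like the root of the logarithm of the
  dimension before the mixture becomes distinguishable from pure noise.
\<close>

lemma mixture_close:
  assumes I: "finite I" "I \<noteq> {}" and A: "A \<in> sets (gauss I)"
    and \<epsilon>: "0 \<le> \<epsilon>" "exp (a\<^sup>2) \<le> 1 + real (card I) * \<epsilon>\<^sup>2"
  shows "\<bar>(\<Sum>j\<in>I. measure (gauss I) {x \<in> space (gauss I). x(j := x j + a) \<in> A}) / card I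
           - measure (gauss I) A\<bar> \<le> \<epsilon>"
proof -
  interpret prob_space "gauss I" by (rule prob_space_gauss)
  let ?n = "real (card I)"
  have n: "?n > 0" using I by (simp add: card_gt_0_iff)
  \<comment> \<open>\<open>g\<close> is the density of the mixture with respect to the noise, and the expectation of \<open>X\<close> is the
    difference of the two probabilities of \<open>A\<close>.\<close>
  define g where "g x = (\<Sum>j\<in>I. tilt a j x) / ?n" for x :: "'a \<Rightarrow> real"
  define X where "X x = indicator A x * (g x - 1)" for x
  have sq: "(g x)\<^sup>2 = (\<Sum>i\<in>I. \<Sum>j\<in>I. tilt a i x * tilt a j x) / ?n\<^sup>2" for x
    by (simp add: g_def power_divide power2_eq_square[of "sum _ _"] sum_product)
  have int1: "integrable (gauss I) (\<lambda>x. tilt a j x)" "(LINT x|gauss I. tilt a j x) = 1" if "j \<in> I" for j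
    using nn_integral_eq_integrable[of "tilt a j" "gauss I" 1] nn_integral_tilt[OF I(1) that, of a] that
    by (auto simp: tilt_nonneg)
  have g: "integrable (gauss I) g" "expectation g = 1"
    unfolding g_def using int1 n by (auto simp: Bochner_Integration.integral_sum)
  have g2: "integrable (gauss I) (\<lambda>x. (g x)\<^sup>2)"
    unfolding sq using tilt_mult[OF I(1)] by auto
  have "expectation (\<lambda>x. (g x)\<^sup>2) = (\<Sum>i\<in>I. \<Sum>j\<in>I. if i = j then exp (a\<^sup>2) else 1) / ?n\<^sup>2"
    unfolding sq using tilt_mult[OF I(1)]
    by (simp add: Bochner_Integration.integral_sum Bochner_Integration.integrable_sum)
  also have "(\<Sum>i\<in>I. \<Sum>j\<in>I. if i = j then exp (a\<^sup>2) else 1) = (\<Sum>i\<in>I. exp (a\<^sup>2) - 1 + ?n)"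
  proof (intro sum.cong refl)
    fix i assume i: "i \<in> I"
    have "(\<Sum>j\<in>I. if i = j then exp (a\<^sup>2) else 1) = (\<Sum>j\<in>I. (if i = j then exp (a\<^sup>2) - 1 else 0) + 1)"
      by (intro sum.cong) auto
    then show "(\<Sum>j\<in>I. if i = j then exp (a\<^sup>2) else 1) = exp (a\<^sup>2) - 1 + ?n"
      using i I by (simp add: sum.distrib)
  qed
  also have "\<dots> = ?n * (exp (a\<^sup>2) - 1) + ?n * ?n"
    by (simp add: algebra_simps)
  also have "\<dots> / ?n\<^sup>2 = 1 + (exp (a\<^sup>2) - 1) / ?n"
    using n by (simp add: field_simps power2_eq_square)
  also have "\<dots> \<le> 1 + \<epsilon>\<^sup>2"
    using n \<epsilon>(2) by (simp add: field_simps)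
  finally have Eg2: "expectation (\<lambda>x. (g x)\<^sup>2) \<le> 1 + \<epsilon>\<^sup>2" .
  have c: "(\<lambda>x. (g x - 1)\<^sup>2) = (\<lambda>x. (g x)\<^sup>2 - 2 * g x + 1)"
    by (auto simp: power2_eq_square algebra_simps)
  have gm1: "integrable (gauss I) (\<lambda>x. (g x - 1)\<^sup>2)" "expectation (\<lambda>x. (g x - 1)\<^sup>2) \<le> \<epsilon>\<^sup>2"
    unfolding c using g g2 Eg2 by (auto simp: prob_space)
  have gmeas [measurable]: "g \<in> borel_measurable (gauss I)" using g by auto
  have X2: "integrable (gauss I) (\<lambda>x. (X x)\<^sup>2)"
    by (rule Bochner_Integration.integrable_bound[OF gm1(1)])
       (use A in \<open>auto simp: X_def split: split_indicator\<close>)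
  have X1: "integrable (gauss I) X"
    by (rule Bochner_Integration.integrable_bound[of _ "\<lambda>x. g x - 1"])
       (use A g in \<open>auto simp: X_def[abs_def] split: split_indicator\<close>)
  have "(expectation X)\<^sup>2 \<le> expectation (\<lambda>x. (X x)\<^sup>2)"
    using variance_positive[of X] variance_eq[OF X1 X2] by simp
  also have "\<dots> \<le> expectation (\<lambda>x. (g x - 1)\<^sup>2)"
    by (intro integral_mono X2 gm1) (auto simp: X_def split: split_indicator)
  also have "\<dots> \<le> \<epsilon>\<^sup>2" by (rule gm1)
  finally have "\<bar>expectation X\<bar> \<le> \<epsilon>"
    using \<epsilon>(1) by (simp add: abs_le_square_iff[symmetric])
  moreover have "expectation X = (\<Sum>j\<in>I. measure (gauss I) {x \<in> space (gauss I). x(j := x j + a) \<in> A}) / ?n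
           - measure (gauss I) A"
  proof -
    have "X = (\<lambda>x. (\<Sum>j\<in>I. indicator A x * tilt a j x) / ?n - indicator A x)"
      by (auto simp: X_def g_def algebra_simps sum_distrib_left)
    moreover have "integrable (gauss I) (\<lambda>x. (\<Sum>j\<in>I. indicator A x * tilt a j x) / ?n)"
      using integral_tilt_indicator(1)[OF I(1) _ A] by (intro Bochner_Integration.integrable_divide_zero Bochner_Integration.integrable_sum) auto
    moreover have "integrable (gauss I) (\<lambda>x. indicator A x :: real)"
      using A by (simp add: less_top[symmetric])
    ultimately show ?thesis
      using A integral_tilt_indicator[OF I(1) _ A, of _ a]
      by (simp add: Bochner_Integration.integral_diff Bochner_Integration.integral_sum)
  qed
  ultimately show ?thesis by simp
qed

section \<open>Tails and quantiles of the standard normal distribution\<close>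

lemma tail_eq: "1 - cdf std_normal_distribution z = measure std_normal_distribution {z<..}"
proof -
  interpret prob_space std_normal_distribution by (rule prob_space_std_normal)
  have "{z<..} = space std_normal_distribution - {..z}" by auto
  then show ?thesis using prob_compl[of "{..z}"] by (simp add: cdf_def)
qed

lemma std_normal_reflect:
  "measure std_normal_distribution {..<- z} = measure std_normal_distribution {z<..}"
proof -
  have "emeasure std_normal_distribution {..<- z}
      = (\<integral>\<^sup>+ y. ennreal (std_normal_density y) * indicator {..<- z} y \<partial>lborel)"
    by (subst emeasure_density) auto
  also have "\<dots> = (\<integral>\<^sup>+ y. ennreal (std_normal_density (- y)) * indicator {..<- z} (- y) \<partial>lborel)"
    using nn_integral_real_affine[of "\<lambda>y. ennreal (std_normal_density y) * indicator {..<- z} y" "-1" 0]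
    by simp
  also have "\<dots> = (\<integral>\<^sup>+ y. ennreal (std_normal_density y) * indicator {z<..} y \<partial>lborel)"
    by (intro nn_integral_cong) (auto simp: std_normal_density_def split: split_indicator)
  also have "\<dots> = emeasure std_normal_distribution {z<..}"
    by (subst emeasure_density) auto
  finally show ?thesis by (simp add: measure_def)
qed

text \<open>
  The normal density vanishes nowhere. Applied to points and to intervals this makes the distribution
  function continuous and strictly increasing.
\<close>

lemma std_normal_null_iff:
  assumes "A \<in> sets borel"
  shows "measure std_normal_distribution A = 0 \<longleftrightarrow> emeasure lborel A = 0"
proof -
  interpret prob_space std_normal_distribution by (rule prob_space_std_normal)
  have pos: "\<not> std_normal_density x \<le> 0" "std_normal_density x \<noteq> 0" for x
    using normal_density_pos[of 1 0 x] by linarith+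
  have "measure std_normal_distribution A = 0 \<longleftrightarrow> A \<in> null_sets std_normal_distribution"
    using assms by (auto simp: null_sets_def emeasure_eq_measure)
  also have "\<dots> \<longleftrightarrow> (AE x in lborel. x \<notin> A)"
    using assms pos by (subst null_sets_density_iff) auto
  also have "\<dots> \<longleftrightarrow> emeasure lborel A = 0"
    using assms by (subst AE_iff_null_sets[symmetric]) (auto simp: null_sets_def)
  finally show ?thesis .
qed

lemma tail_nonpos_ge_half:
  assumes "z \<le> 0" shows "1 / 2 \<le> measure std_normal_distribution {z<..}"
proof -
  interpret prob_space std_normal_distribution by (rule prob_space_std_normal)
  have UN: "{..<-0} \<union> {0<..} \<union> {0} = (UNIV :: real set)" by auto
  have "1 = prob ({..<-0} \<union> {0<..} \<union> {0})"
    using prob_space UN by simp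
  also have "\<dots> \<le> prob {..<-0} + prob {0<..} + prob {0}"
    by (intro order.trans[OF measure_Un_le] add_mono order.refl measure_Un_le) auto
  also have "\<dots> = 2 * prob {0<..}"
    using std_normal_null_iff[of "{0}"] std_normal_reflect[of 0] by simp
  also have "prob {0<..} \<le> prob {z<..}"
    using assms by (intro finite_measure_mono) auto
  finally show ?thesis by simp
qed

text \<open>
  The Chernoff bound: on \<open>{z<..}\<close> the likelihood ratio \<open>exp (z * y - z\<^sup>2 / 2)\<close> of the shift by \<open>z\<close>,
  whose mean is \<open>1\<close>, is at least \<open>exp (z\<^sup>2 / 2)\<close>.
\<close>

lemma tail_le_exp:
  assumes "0 \<le> z"
  shows "measure std_normal_distribution {z<..} \<le> exp (- z\<^sup>2 / 2)"
proof -
  interpret prob_space std_normal_distribution by (rule prob_space_std_normal)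
  have "ennreal (prob {z<..}) = (\<integral>\<^sup>+ y. indicator {z<..} y \<partial>std_normal_distribution)"
    by (simp add: emeasure_eq_measure)
  also have "\<dots> \<le> (\<integral>\<^sup>+ y. ennreal (exp (- z\<^sup>2 / 2)) * ennreal (exp (z * y - z\<^sup>2 / 2)) \<partial>std_normal_distribution)"
  proof (intro nn_integral_mono)
    fix y :: real
    have "1 \<le> exp (- z\<^sup>2 / 2) * exp (z * y - z\<^sup>2 / 2)" if "z < y"
    proof -
      have "z * z \<le> z * y" using that assms by (intro mult_left_mono) auto
      then show ?thesis by (simp add: exp_add[symmetric] power2_eq_square)
    qed
    then show "indicator {z<..} y \<le> ennreal (exp (- z\<^sup>2 / 2)) * ennreal (exp (z * y - z\<^sup>2 / 2))"
      by (auto simp: ennreal_mult[symmetric] simp del: ennreal_1 simp flip: ennreal_1 split: split_indicator)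
  qed
  also have "\<dots> = ennreal (exp (- z\<^sup>2 / 2)) * (\<integral>\<^sup>+ y. 1 * ennreal (exp (z * y - z\<^sup>2 / 2)) \<partial>std_normal_distribution)"
    by (subst nn_integral_cmult) auto
  also have "(\<integral>\<^sup>+ y. 1 * ennreal (exp (z * y - z\<^sup>2 / 2)) \<partial>std_normal_distribution) = 1"
    using std_normal_translate[of "\<lambda>_. 1" z] emeasure_space_1 by simp
  finally show ?thesis by (simp add: ennreal_le_iff)
qed

text \<open>
  The quantile is a definite description, so both existence (intermediate value theorem) and
  uniqueness (strict monotonicity) have to be supplied.
\<close>

lemma upper_quantile_tail:
  assumes "0 < \<beta>" "\<beta> < 1"
  shows "measure std_normal_distribution {upper_quantile \<beta><..} = \<beta>"
proof -
  interpret real_distribution std_normal_distribution by (rule real_dist_normal_dist)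
  let ?F = "cdf std_normal_distribution"
  have cont: "isCont ?F x" for x
    using std_normal_null_iff[of "{x}"] by (simp add: isCont_cdf)
  have "eventually (\<lambda>x. ?F x < 1 - \<beta>) at_bot"
    using assms by (intro order_tendstoD(2)[OF cdf_lim_at_bot]) auto
  then obtain p where p: "?F p < 1 - \<beta>" by (auto simp: eventually_at_bot_linorder)
  have "eventually (\<lambda>x. ?F x > 1 - \<beta>) at_top"
    using assms by (intro order_tendstoD(1)[OF cdf_lim_at_top_prob]) auto
  then obtain q where q: "?F q > 1 - \<beta>" by (auto simp: eventually_at_top_linorder)
  have "p \<le> q" using p q cdf_nondecreasing[of q p] by linarith
  then obtain z where z: "?F z = 1 - \<beta>"
    using IVT'[of ?F p "1 - \<beta>" q] p q cont by (auto intro: continuous_at_imp_continuous_on)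
  have strict: "?F x < ?F y" if "x < y" for x y
  proof -
    have "measure std_normal_distribution {x<..y} \<noteq> 0"
      using std_normal_null_iff[of "{x<..y}"] that by simp
    then have "0 < measure std_normal_distribution {x<..y}"
      by (simp add: zero_less_measure_iff)
    then show ?thesis using cdf_diff_eq[OF that] by linarith
  qed
  have "(THE z. 1 - ?F z = \<beta>) = z"
  proof (rule the_equality)
    fix w assume "1 - ?F w = \<beta>"
    then show "w = z" using z strict[of w z] strict[of z w] by linarith
  qed (use z in simp)
  then show ?thesis using z by (simp add: upper_quantile_def tail_eq[symmetric])
qed

lemma upper_quantile_pos:
  assumes "0 < \<beta>" "\<beta> < 1 / 2" shows "0 < upper_quantile \<beta>"
  using tail_nonpos_ge_half[of "upper_quantile \<beta>"] upper_quantile_tail[of \<beta>] assms by fastforce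

lemma upper_quantile_le:
  assumes "0 < \<beta>" "\<beta> < 1 / 2" shows "upper_quantile \<beta> \<le> sqrt (2 * ln (1 / \<beta>))"
proof (rule real_le_rsqrt)
  have "ln \<beta> \<le> ln (exp (- (upper_quantile \<beta>)\<^sup>2 / 2))"
    using tail_le_exp[of "upper_quantile \<beta>"] upper_quantile_pos[OF assms] upper_quantile_tail[of \<beta>] assms
    by (subst ln_le_cancel_iff) auto
  then show "(upper_quantile \<beta>)\<^sup>2 \<le> 2 * ln (1 / \<beta>)"
    using assms by (simp add: ln_div)
qed

section \<open>Observations and coverage\<close>

definition observe :: "nat \<Rightarrow> real \<Rightarrow> (nat \<Rightarrow> real) \<Rightarrow> (nat \<Rightarrow> real) \<Rightarrow> nat \<Rightarrow> real" where
  "observe n \<sigma> f e = (\<lambda>i\<in>{1..n}. f i + \<sigma> * e i)"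

lemma observe_measurable [measurable]: "observe n \<sigma> f \<in> measurable (gauss {1..n}) (Rn n)"
  unfolding observe_def
  by (intro measurable_restrict borel_measurable_add borel_measurable_const borel_measurable_times measurable_coord)

lemma obs_law_eq: "obs_law n \<sigma> f = distr (gauss {1..n}) (Rn n) (observe n \<sigma> f)"
  by (simp add: obs_law_def observe_def[abs_def])

lemma sets_obs_law [simp]: "sets (obs_law n \<sigma> f) = sets (Rn n)"
  by (simp add: obs_law_eq)

lemma prob_space_obs_law: "prob_space (obs_law n \<sigma> f)"
  unfolding obs_law_eq by (intro prob_space.prob_space_distr prob_space_gauss observe_measurable)

lemma measure_obs_law:
  assumes "B \<in> sets (Rn n)"
  shows "measure (obs_law n \<sigma> f) B = measure (gauss {1..n}) {e \<in> space (gauss {1..n}). observe n \<sigma> f e \<in> B}"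
  unfolding obs_law_eq using assms
  by (subst measure_distr) (auto simp: vimage_def Int_def conj_commute simp del: One_nat_def)

text \<open>
  Moving the mean by \<open>\<sigma> * a\<close> along an axis is the same as moving the noise by \<open>a\<close>, so results on
  translated noise compare the laws of the observations under different means.
\<close>

lemma observe_shift:
  "j \<in> {1..n} \<Longrightarrow> observe n \<sigma> (f(j := f j + \<sigma> * a)) e = observe n \<sigma> f (e(j := e j + a))"
  by (auto simp: observe_def restrict_def fun_eq_iff algebra_simps)

definition covers :: "nat \<Rightarrow> ((nat \<Rightarrow> real) \<Rightarrow> nat \<Rightarrow> real) \<Rightarrow> ((nat \<Rightarrow> real) \<Rightarrow> nat \<Rightarrow> real) \<Rightarrow> (nat \<Rightarrow> real) \<Rightarrow> (nat \<Rightarrow> real) set" where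
  "covers n L U f = {y \<in> space (Rn n). \<forall>i\<in>{1..n}. L y i \<le> f i \<and> f i \<le> U y i}"

lemma band_measurable:
  assumes "band n L U" "i \<in> {1..n}"
  shows "(\<lambda>y. L y i) \<in> borel_measurable (Rn n)" "(\<lambda>y. U y i) \<in> borel_measurable (Rn n)"
  using assms(1) measurable_compose[OF _ measurable_component_singleton[OF assms(2)]]
  unfolding band_def by blast+

lemma sets_covers:
  assumes "band n L U" shows "covers n L U f \<in> sets (Rn n)"
  unfolding covers_def
  by (intro sets.sets_Collect_finite_All sets.sets_Collect_conj borel_measurable_le
      borel_measurable_const band_measurable[OF assms] finite_atLeastAtMost)

lemma sets_wide:
  assumes "band n L U"
  shows "{y \<in> space (Rn n). \<exists>i\<in>{1..n}. w \<le> U y i - L y i} \<in> sets (Rn n)"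
  by (intro sets.sets_Collect_finite_Ex borel_measurable_le borel_measurable_diff
      borel_measurable_const band_measurable[OF assms] finite_atLeastAtMost)

lemma confidence_band_covers:
  assumes "confidence_band n \<sigma> \<alpha> L U" "f \<in> space (Rn n)"
  shows "1 - \<alpha> \<le> measure (obs_law n \<sigma> f) (covers n L U f)"
proof -
  have "(INF f\<in>space (Rn n). measure (obs_law n \<sigma> f) (covers n L U f)) \<le> measure (obs_law n \<sigma> f) (covers n L U f)"
    by (rule cINF_lower[OF _ assms(2)]) (auto intro!: bdd_belowI2[of _ 0])
  then show ?thesis using assms(1) by (simp add: confidence_band_def covers_def)
qed

section \<open>Every confidence band is wide\<close>

text \<open>
  Write \<open>f' j\<close> for the mean \<open>f\<close> raised by \<open>\<sigma> * a\<close> in coordinate \<open>j\<close>. A band that covers both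
  \<open>f\<close> and \<open>f' j\<close> is at least \<open>\<sigma> * a\<close> wide in coordinate \<open>j\<close>. Under \<open>f' j\<close> it covers \<open>f' j\<close> up
  to an error \<open>\<alpha>\<close>; on average over \<open>j\<close> it also covers \<open>f\<close>, up to \<open>\<alpha> + \<epsilon>\<close>, because the mixture of
  the laws under \<open>f' j\<close> is \<open>\<epsilon>\<close>-close to the law under \<open>f\<close>. One more comparison with the mixture
  brings the resulting bound for the event of a wide band back to the law under \<open>f\<close> and costs the
  second \<open>\<epsilon>\<close>.
\<close>

lemma prob_wide:
  assumes cb: "confidence_band n \<sigma> \<alpha> L U" and f: "f \<in> space (Rn n)" and n: "1 \<le> n"
    and \<epsilon>: "0 \<le> \<epsilon>" "exp (a\<^sup>2) \<le> 1 + real n * \<epsilon>\<^sup>2"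
  shows "1 - 2 * \<alpha> - 2 * \<epsilon> \<le> measure (obs_law n \<sigma> f)
           {y \<in> space (Rn n). \<exists>i\<in>{1..n}. \<sigma> * a \<le> U y i - L y i}" (is "_ \<le> measure _ ?W")
proof -
  let ?G = "gauss {1..n}"
  interpret prob_space ?G by (rule prob_space_gauss)
  have band: "band n L U" using cb by (simp add: confidence_band_def)
  have W: "?W \<in> sets (Rn n)" by (rule sets_wide[OF band])
  define f' where "f' j = f(j := f j + \<sigma> * a)" for j
  define S where "S B = {e \<in> space ?G. observe n \<sigma> f e \<in> B}" for B
  have S [measurable]: "S B \<in> sets ?G" if "B \<in> sets (Rn n)" for B
    using measurable_sets[OF observe_measurable that, of \<sigma> f]
    by (simp add: S_def vimage_def Int_def conj_commute)
  \<comment> \<open>\<open>q j B\<close> is the probability of \<open>B\<close> when the mean is \<open>f' j\<close>, expressed through translated noise.\<close>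
  define q where "q j B = prob {e \<in> space ?G. e(j := e j + a) \<in> S B}" for j B
  have q: "q j B = measure (obs_law n \<sigma> (f' j)) B" if "j \<in> {1..n}" "B \<in> sets (Rn n)" for j B
  proof -
    have "e(j := e j + a) \<in> space ?G" if "e \<in> space ?G" for e
      using measurable_space[OF translate_measurable[OF \<open>j \<in> {1..n}\<close>] that] .
    then show ?thesis
      unfolding q_def measure_obs_law[OF that(2)] f'_def S_def
      by (intro arg_cong[where f = prob] Collect_cong) (auto simp only: observe_shift[OF that(1)] mem_Collect_eq)
  qed
  have p: "prob (S B) = measure (obs_law n \<sigma> f) B" if "B \<in> sets (Rn n)" for B
    unfolding measure_obs_law[OF that] S_def ..
  have close: "\<bar>(\<Sum>j\<in>{1..n}. q j B) / n - measure (obs_law n \<sigma> f) B\<bar> \<le> \<epsilon>" if "B \<in> sets (Rn n)" for B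
    using mixture_close[OF _ _ S[OF that] \<epsilon>(1), of a] n \<epsilon>(2) by (simp add: q_def p[OF that, symmetric] del: One_nat_def)
  let ?C = "covers n L U f"
  have step: "q j ?C - \<alpha> \<le> q j ?W" if j: "j \<in> {1..n}" for j
  proof -
    interpret P: prob_space "obs_law n \<sigma> (f' j)" by (rule prob_space_obs_law)
    let ?D = "covers n L U (f' j)"
    have CP: "?C \<in> P.events" and DP: "?D \<in> P.events"
      unfolding sets_obs_law by (rule sets_covers[OF band])+
    have f': "f' j \<in> space (Rn n)" using f j by (auto simp: f'_def space_PiM PiE_def extensional_def)
    have CD: "?C \<inter> ?D \<subseteq> ?W"
    proof
      fix y assume y: "y \<in> ?C \<inter> ?D"
      then have "L y j \<le> f j" "f' j j \<le> U y j" using j unfolding covers_def by blast+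
      then have "\<sigma> * a \<le> U y j - L y j" by (simp add: f'_def)
      then show "y \<in> ?W" using j y unfolding covers_def by blast
    qed
    have "P.prob ?C - P.prob (?C \<inter> ?D) = P.prob (?C - ?D)"
      by (rule P.finite_measure_Diff'[OF CP DP, symmetric])
    also have "\<dots> \<le> P.prob (space (obs_law n \<sigma> (f' j)) - ?D)"
      using sets.sets_into_space[OF CP] by (intro P.finite_measure_mono sets.compl_sets DP) auto
    also have "\<dots> \<le> \<alpha>"
      using confidence_band_covers[OF cb f'] P.prob_compl[OF DP] by simp
    finally have "P.prob ?C - \<alpha> \<le> P.prob (?C \<inter> ?D)" by linarith
    also have "\<dots> \<le> P.prob ?W"
      by (rule P.finite_measure_mono[OF CD]) (use W in \<open>simp only: sets_obs_law\<close>)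
    finally show ?thesis unfolding q[OF j W] q[OF j sets_covers[OF band]] .
  qed
  have "(\<Sum>j\<in>{1..n}. q j ?C) - n * \<alpha> = (\<Sum>j\<in>{1..n}. q j ?C - \<alpha>)"
    by (simp add: sum_subtractf)
  also have "\<dots> \<le> (\<Sum>j\<in>{1..n}. q j ?W)" by (intro sum_mono step)
  finally have "(\<Sum>j\<in>{1..n}. q j ?C) / n - \<alpha> \<le> (\<Sum>j\<in>{1..n}. q j ?W) / n"
    using n divide_right_mono[of "(\<Sum>j\<in>{1..n}. q j ?C) - n * \<alpha>" "\<Sum>j\<in>{1..n}. q j ?W" "real n"]
    by (simp add: diff_divide_distrib del: One_nat_def)
  then show ?thesis
    using close[OF W] close[OF sets_covers[OF band], of f] confidence_band_covers[OF cb f] by linarith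
qed

text \<open>
  The shift \<open>a\<close> is chosen so that \<open>exp (a\<^sup>2) = n * \<epsilon>\<^sup>2\<close>; Markov's inequality turns the probability of
  a wide band into a bound for the mean width.
\<close>

lemma expected_width_ge:
  assumes \<sigma>: "0 < \<sigma>" and cb: "confidence_band n \<sigma> \<alpha> L U" and f: "f \<in> space (Rn n)"
    and \<epsilon>: "0 < \<epsilon>" "1 \<le> real n * \<epsilon>\<^sup>2"
  shows "ennreal ((1 - 2 * \<alpha> - 2 * \<epsilon>) * \<sigma> * sqrt (ln (real n * \<epsilon>\<^sup>2))) \<le> expected_width n \<sigma> L U f"
proof -
  interpret P: prob_space "obs_law n \<sigma> f" by (rule prob_space_obs_law)
  define a where "a = sqrt (ln (real n * \<epsilon>\<^sup>2))"
  have a: "0 \<le> a" "exp (a\<^sup>2) = real n * \<epsilon>\<^sup>2" using \<epsilon>(2) by (auto simp: a_def)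
  have n: "1 \<le> n" using \<epsilon> by (cases n) auto
  let ?W = "{y \<in> space (Rn n). \<exists>i\<in>{1..n}. \<sigma> * a \<le> U y i - L y i}"
  have band: "band n L U" using cb by (simp add: confidence_band_def)
  have W: "?W \<in> sets (obs_law n \<sigma> f)" unfolding sets_obs_law by (rule sets_wide[OF band])
  have "ennreal ((1 - 2 * \<alpha> - 2 * \<epsilon>) * \<sigma> * a) \<le> ennreal (\<sigma> * a * P.prob ?W)"
    using mult_right_mono[OF prob_wide[OF cb f n _ , of \<epsilon> a], of "\<sigma> * a"] \<epsilon> a \<sigma>
    by (intro ennreal_leI) (simp add: mult_ac)
  also have "\<dots> = (\<integral>\<^sup>+ y. ennreal (\<sigma> * a) * indicator ?W y \<partial>obs_law n \<sigma> f)"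
    using \<sigma> a by (simp only: nn_integral_cmult_indicator[OF W] P.emeasure_eq_measure ennreal_mult
        mult_nonneg_nonneg less_imp_le measure_nonneg)
  also have "\<dots> \<le> expected_width n \<sigma> L U f"
    unfolding expected_width_def
  proof (intro nn_integral_mono)
    fix y
    have "\<sigma> * a \<le> width n L U y" if "y \<in> ?W"
    proof -
      from that obtain i where i: "i \<in> {1..n}" "\<sigma> * a \<le> U y i - L y i" by blast
      have "U y i - L y i \<le> width n L U y"
        unfolding width_def using i(1) by (intro Max_ge finite_imageI imageI) auto
      with i(2) show ?thesis by linarith
    qed
    then show "ennreal (\<sigma> * a) * indicator ?W y \<le> ennreal (width n L U y)"
      by (auto intro: ennreal_leI split: split_indicator)
  qed
  finally show ?thesis by (simp add: a_def)
qed

section \<open>The Bonferroni band\<close>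

lemma measure_gauss_coord:
  assumes "i \<in> I" "B \<in> sets borel"
  shows "measure (gauss I) {e \<in> space (gauss I). e i \<in> B} = measure std_normal_distribution B"
proof -
  have "measure std_normal_distribution B = measure (distr (gauss I) std_normal_distribution (\<lambda>e. e i)) B"
    using assms by (subst distr_PiM_component[of I "\<lambda>_. std_normal_distribution"]) (auto intro: prob_space_std_normal)
  also have "\<dots> = measure (gauss I) {e \<in> space (gauss I). e i \<in> B}"
    using assms by (subst measure_distr) (auto simp: vimage_def Int_def conj_commute)
  finally show ?thesis ..
qed

text \<open>
  Coverage of \<open>f\<close> fails exactly if some noise coordinate exceeds the quantile in absolute value. Each
  coordinate does so with probability \<open>\<alpha> / n\<close>, whatever \<open>f\<close> is.
\<close>

lemma bonferroni_confidence_band: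
  assumes \<alpha>: "0 < \<alpha>" "\<alpha> < 1" and n: "1 \<le> n" and \<sigma>: "0 < \<sigma>"
  shows "confidence_band n \<sigma> \<alpha> (bonferroni_lower n \<sigma> \<alpha>) (bonferroni_upper n \<sigma> \<alpha>)"
    (is "confidence_band n \<sigma> \<alpha> ?L ?U")
proof -
  let ?G = "gauss {1..n}"
  interpret prob_space ?G by (rule prob_space_gauss)
  define z where "z = upper_quantile (\<alpha> / (2 * real n))"
  have \<beta>: "0 < \<alpha> / (2 * real n)" "\<alpha> / (2 * real n) < 1 / 2"
    using \<alpha> n by (auto simp: field_simps)
  have z: "0 < z" "measure std_normal_distribution {z<..} = \<alpha> / (2 * real n)"
    using upper_quantile_pos[OF \<beta>] upper_quantile_tail[OF \<beta>(1)] \<beta> by (auto simp: z_def)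
  have band: "band n ?L ?U"
    unfolding band_def bonferroni_lower_def bonferroni_upper_def z_def[symmetric]
    using z \<sigma> by (auto intro!: measurable_restrict)
  have "1 - \<alpha> \<le> measure (obs_law n \<sigma> f) (covers n ?L ?U f)" for f
  proof -
    let ?E = "\<lambda>i B. {e \<in> space ?G. e i \<in> B}"
    let ?S = "{e \<in> space ?G. observe n \<sigma> f e \<in> covers n ?L ?U f}"
    have E: "?E i B \<in> sets ?G" if "i \<in> {1..n}" "B \<in> sets borel" for i B
      using measurable_sets[OF measurable_coord[OF that(1)] that(2)]
      by (simp add: vimage_def Int_def conj_commute)
    have S: "?S \<in> sets ?G"
      using measurable_sets[OF observe_measurable sets_covers[OF band]]
      by (simp add: vimage_def Int_def conj_commute)
    have T: "{..<-z} \<union> {z<..} \<in> sets borel" by simp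
    have "space ?G - ?S \<subseteq> (\<Union>i\<in>{1..n}. ?E i ({..<-z} \<union> {z<..}))"
    proof
      fix e assume e: "e \<in> space ?G - ?S"
      have "observe n \<sigma> f e \<in> space (Rn n)"
        using e by (intro measurable_space[OF observe_measurable]) auto
      then obtain i where i: "i \<in> {1..n}" "\<not> (?L (observe n \<sigma> f e) i \<le> f i \<and> f i \<le> ?U (observe n \<sigma> f e) i)"
        using e by (auto simp: covers_def)
      have "\<sigma> * z < \<sigma> * e i \<or> \<sigma> * e i < \<sigma> * (- z)"
        using i by (auto simp: bonferroni_lower_def bonferroni_upper_def observe_def z_def[symmetric])
      then have "z < e i \<or> e i < - z" using \<sigma> by (simp only: mult_less_cancel_left_pos)
      then show "e \<in> (\<Union>i\<in>{1..n}. ?E i ({..<-z} \<union> {z<..}))" using e i by auto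
    qed
    then have "prob (space ?G - ?S) \<le> prob (\<Union>i\<in>{1..n}. ?E i ({..<-z} \<union> {z<..}))"
      by (intro finite_measure_mono sets.finite_UN E T) auto
    also have "\<dots> \<le> (\<Sum>i\<in>{1..n}. prob (?E i ({..<-z} \<union> {z<..})))"
      by (intro finite_measure_subadditive_finite image_subsetI E T) auto
    also have "\<dots> \<le> (\<Sum>i\<in>{1..n}. \<alpha> / n)"
    proof (intro sum_mono)
      fix i assume i: "i \<in> {1..n}"
      have "prob (?E i ({..<-z} \<union> {z<..})) = measure std_normal_distribution ({..<-z} \<union> {z<..})"
        by (intro measure_gauss_coord i T)
      also have "\<dots> \<le> measure std_normal_distribution {..<-z} + measure std_normal_distribution {z<..}"
        by (intro measure_Un_le) auto
      also have "\<dots> = \<alpha> / n" by (simp add: std_normal_reflect z(2))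
      finally show "prob (?E i ({..<-z} \<union> {z<..})) \<le> \<alpha> / n" .
    qed
    also have "\<dots> = \<alpha>" using n by simp
    finally show ?thesis
      using prob_compl[OF S] by (simp add: measure_obs_law[OF sets_covers[OF band]])
  qed
  moreover have "space (Rn n) \<noteq> {}" by (simp add: space_PiM PiE_eq_empty_iff)
  ultimately show ?thesis
    unfolding confidence_band_def covers_def[symmetric] using band by (auto intro: cINF_greatest)
qed

lemma bonferroni_width:
  assumes "1 \<le> n"
  shows "width n (bonferroni_lower n \<sigma> \<alpha>) (bonferroni_upper n \<sigma> \<alpha>) y = 2 * \<sigma> * upper_quantile (\<alpha> / (2 * real n))"
proof -
  have "(\<lambda>i. bonferroni_upper n \<sigma> \<alpha> y i - bonferroni_lower n \<sigma> \<alpha> y i) ` {1..n}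
    = (\<lambda>i. 2 * \<sigma> * upper_quantile (\<alpha> / (2 * real n))) ` {1..n}"
    by (intro image_cong) (auto simp: bonferroni_upper_def bonferroni_lower_def)
  also have "\<dots> = {2 * \<sigma> * upper_quantile (\<alpha> / (2 * real n))}" using assms by auto
  finally show ?thesis by (simp add: width_def)
qed

text \<open>
  The Chernoff bound makes the quantile at most \<open>sqrt (2 * ln (2 * n / \<alpha>))\<close>. The second condition on
  \<open>n\<close> says exactly that \<open>2 * n / \<alpha>\<close> does not exceed \<open>(n * \<epsilon>\<^sup>2)\<^sup>2\<close>, so that the two logarithms are
  comparable with a factor \<open>2\<close>.
\<close>

lemma bonferroni_width_le:
  assumes \<alpha>: "0 < \<alpha>" "\<alpha> < 1" and \<epsilon>: "0 < \<epsilon>" and \<sigma>: "0 < \<sigma>"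
    and n: "1 \<le> n" "2 / (\<alpha> * \<epsilon> ^ 4) \<le> real n"
  shows "2 * \<sigma> * upper_quantile (\<alpha> / (2 * real n)) \<le> 4 * (\<sigma> * sqrt (ln (real n * \<epsilon>\<^sup>2)))"
proof -
  have "2 * real n / \<alpha> \<le> (real n * \<epsilon>\<^sup>2)\<^sup>2"
  proof -
    have "2 / \<alpha> \<le> real n * \<epsilon> ^ 4" using n(2) \<alpha> \<epsilon> by (simp add: field_simps)
    from mult_left_mono[OF this, of "real n"] show ?thesis
      by (simp add: power_mult_distrib power2_eq_square power4_eq_xxxx mult_ac)
  qed
  then have "ln (2 * real n / \<alpha>) \<le> ln ((real n * \<epsilon>\<^sup>2)\<^sup>2)"
    using n \<alpha> \<epsilon> by (subst ln_le_cancel_iff) auto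
  also have "\<dots> = 2 * ln (real n * \<epsilon>\<^sup>2)"
    using n \<epsilon> by (subst ln_realpow) auto
  finally have "sqrt (2 * ln (2 * real n / \<alpha>)) \<le> sqrt (4 * ln (real n * \<epsilon>\<^sup>2))"
    by (intro real_sqrt_le_mono) simp
  moreover have "upper_quantile (\<alpha> / (2 * real n)) \<le> sqrt (2 * ln (2 * real n / \<alpha>))"
    using upper_quantile_le[of "\<alpha> / (2 * real n)"] \<alpha> n by (simp add: field_simps)
  ultimately have "upper_quantile (\<alpha> / (2 * real n)) \<le> 2 * sqrt (ln (real n * \<epsilon>\<^sup>2))"
    by (simp add: real_sqrt_mult)
  from mult_left_mono[OF this, of "2 * \<sigma>"] show ?thesis using \<sigma> by (simp add: mult_ac)
qed

theorem mainTheorem2: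
  fixes \<alpha> :: real
  assumes "0 < \<alpha>" "\<alpha> < 1 / 2"
  shows
    "(\<forall>(n::nat) (\<sigma>::real) L U (\<epsilon>::real).
        0 < \<sigma> \<longrightarrow> confidence_band n \<sigma> \<alpha> L U \<longrightarrow>
        0 < \<epsilon> \<longrightarrow> \<epsilon> < 1 / 2 - \<alpha> \<longrightarrow> real n * \<epsilon>\<^sup>2 \<ge> 1 \<longrightarrow>
        (INF f\<in>space (Rn n). expected_width n \<sigma> L U f)
          \<ge> ennreal ((1 - 2 * \<alpha> - 2 * \<epsilon>) * \<sigma> * sqrt (ln (real n * \<epsilon>\<^sup>2))))
     \<and> (\<forall>(n::nat) (\<sigma>::real). 1 \<le> n \<longrightarrow> 0 < \<sigma> \<longrightarrow>
          confidence_band n \<sigma> \<alpha> (bonferroni_lower n \<sigma> \<alpha>) (bonferroni_upper n \<sigma> \<alpha>))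
     \<and> (\<forall>\<epsilon>::real. 0 < \<epsilon> \<longrightarrow> \<epsilon> < 1 / 2 - \<alpha> \<longrightarrow>
          (\<exists>C>0. \<forall>\<^sub>F n in sequentially. \<forall>\<sigma>>0. \<exists>w::real.
             (\<forall>y\<in>space (Rn n).
                width n (bonferroni_lower n \<sigma> \<alpha>) (bonferroni_upper n \<sigma> \<alpha>) y = w) \<and>
             w \<le> C * ((1 - 2 * \<alpha> - 2 * \<epsilon>) * \<sigma> * sqrt (ln (real n * \<epsilon>\<^sup>2)))))"
proof (intro conjI allI impI)
  fix n \<sigma> L U and \<epsilon> :: real
  assume "0 < \<sigma>" "confidence_band n \<sigma> \<alpha> L U" "0 < \<epsilon>" "1 \<le> real n * \<epsilon>\<^sup>2"
  then show "ennreal ((1 - 2 * \<alpha> - 2 * \<epsilon>) * \<sigma> * sqrt (ln (real n * \<epsilon>\<^sup>2)))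
      \<le> (INF f\<in>space (Rn n). expected_width n \<sigma> L U f)"
    by (intro INF_greatest expected_width_ge)
next
  fix n :: nat and \<sigma> :: real
  assume "1 \<le> n" "0 < \<sigma>"
  then show "confidence_band n \<sigma> \<alpha> (bonferroni_lower n \<sigma> \<alpha>) (bonferroni_upper n \<sigma> \<alpha>)"
    using assms by (intro bonferroni_confidence_band) auto
next
  fix \<epsilon> :: real
  assume \<epsilon>: "0 < \<epsilon>" "\<epsilon> < 1 / 2 - \<alpha>"
  define c where "c = 1 - 2 * \<alpha> - 2 * \<epsilon>"
  have c: "0 < c" using \<epsilon> by (simp add: c_def)
  let ?P = "\<lambda>n. \<forall>\<sigma>>0. \<exists>w::real.
     (\<forall>y\<in>space (Rn n). width n (bonferroni_lower n \<sigma> \<alpha>) (bonferroni_upper n \<sigma> \<alpha>) y = w) \<and>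
     w \<le> 4 / c * (c * \<sigma> * sqrt (ln (real n * \<epsilon>\<^sup>2)))"
  have "eventually ?P sequentially"
    using eventually_ge_at_top[of "1 :: nat"] eventually_ge_at_top[of "nat \<lceil>2 / (\<alpha> * \<epsilon> ^ 4)\<rceil>"]
  proof eventually_elim
    case (elim n)
    then have n: "1 \<le> n" "2 / (\<alpha> * \<epsilon> ^ 4) \<le> real n" by linarith+
    show ?case
    proof (intro allI impI exI conjI ballI)
      fix \<sigma> :: real assume \<sigma>: "0 < \<sigma>"
      show "width n (bonferroni_lower n \<sigma> \<alpha>) (bonferroni_upper n \<sigma> \<alpha>) y
          = 2 * \<sigma> * upper_quantile (\<alpha> / (2 * real n))" for y
        by (rule bonferroni_width[OF n(1)])
      show "2 * \<sigma> * upper_quantile (\<alpha> / (2 * real n)) \<le> 4 / c * (c * \<sigma> * sqrt (ln (real n * \<epsilon>\<^sup>2)))"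
        using bonferroni_width_le[OF assms(1) _ \<epsilon>(1) \<sigma> n] assms(2) c by (simp add: mult.assoc)
    qed
  qed
  then show "\<exists>C>0. \<forall>\<^sub>F n in sequentially. \<forall>\<sigma>>0. \<exists>w::real.
             (\<forall>y\<in>space (Rn n).
                width n (bonferroni_lower n \<sigma> \<alpha>) (bonferroni_upper n \<sigma> \<alpha>) y = w) \<and>
             w \<le> C * ((1 - 2 * \<alpha> - 2 * \<epsilon>) * \<sigma> * sqrt (ln (real n * \<epsilon>\<^sup>2)))"
    using c unfolding c_def[symmetric] by (intro exI[of _ "4 / c"]) simp
qed

end
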